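(* Let $\mathbf a\in\{(2,0,0),(0,2,0),(0,0,2)\}$, $\alpha\in\mathbb{C}$ and $K(h)\in\mathrm{GL}_2(\mathbb{C}[h])$. The $\mathfrak{sl}(2)$-module $M(\alpha,\mathbf a,K(h))$ is simple if and only if one of the following holds: (1) $\mathbf a=(2,0,0)$ or $\mathbf a=(0,0,2)$, $K(h)\in\mathcal S$, and $\alpha\in\mathbb{C}$ is arbitrary; (2) $\mathbf a=(0,2,0)$, $K(h)\in\mathcal S$, and $\alpha\in\mathbb{C}\setminus\left(\tfrac12\mathbb{Z}_{\ge0}+1\right)$.
   Context: Work over $\mathbb{C}$. $\mathfrak{sl}(2)$ has basis $e,f,h$ with $[h,e]=e$, $[h,f]=-f$, $[e,f]=2h$ (so $h=\mathrm{diag}(\tfrac12,-\tfrac12)$). The letter $h$ is also the variable of $\mathbb{C}[h]$, and $\sigma(p(h))=p(h-1)$, $\sigma^{-1}(p(h))=p(h+1)$, applied entrywise to vectors and matrices over $\mathbb{C}[h]$. For $\alpha\in\mathbb{C}$ and $\mathbf a\in\{(2,0,0),(0,2,0),(0,0,2)\}$ let $p(h)=1$, $h-\alpha+1$, $(h-\alpha+1)(h+\alpha)$ respectively, and let $q(h)\in\mathbb{C}[h]$ be defined by $p(h)q(h)=-(h-\alpha+1)(h+\alpha)$. For $K(h)\in\mathrm{GL}_2(\mathbb{C}[h])$, $M(\alpha,\mathbf a,K(h))$ is the $\mathfrak{sl}(2)$-module with underlying space $\mathbb{C}[h]^{\oplus2}$ (column vectors), where $h$ acts by multiplication by $h$ and,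 for $v\in\mathbb{C}[h]^{\oplus 2}$, $$e\cdot v=\sigma\bigl(q(h)K(h)^{-1}v\bigr),\qquad f\cdot v=p(h)K(h)\,\sigma^{-1}(v).$$ The set $\mathcal S\subset\mathrm{GL}_2(\mathbb{C}[h])$ consists of all $K(h)\in\mathrm{GL}_2(\mathbb{C}[h])$ that are not of the form $P(h)^{-1}\mathrm{diag}(a,b)P(h+1)$ for any $a,b\in\mathbb{C}^*=\mathbb{C}\setminus\{0\}$ and $P(h)\in\mathrm{GL}_2(\mathbb{C}[h])$. *)

theory Defs
  imports
    "HOL-Analysis.Analysis"
    "HOL-Computational_Algebra.Polynomial"
begin

definition sl2 :: "(complex^2^2) set" where
  "sl2 = {x. trace x = 0}"

definition lie_bracket :: "complex^2^2 \<Rightarrow> complex^2^2 \<Rightarrow> complex^2^2" where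
  "lie_bracket x y = x ** y - y ** x"

definition mat2 :: "'a \<Rightarrow> 'a \<Rightarrow> 'a \<Rightarrow> 'a \<Rightarrow> 'a^2^2" where
  "mat2 a b c d = (\<chi> i j. if i = 1 then (if j = 1 then a else b) else (if j = 1 then c else d))"

lemma mat2_nth [simp]:
  "mat2 a b c d $ 1 $ 1 = a" "mat2 a b c d $ 1 $ 2 = b"
  "mat2 a b c d $ 2 $ 1 = c" "mat2 a b c d $ 2 $ 2 = d"
  by (simp_all add: mat2_def)

definition sl2_e :: "complex^2^2" where "sl2_e = mat2 0 1 0 0"
definition sl2_f :: "complex^2^2" where "sl2_f = mat2 0 0 1 0"
definition sl2_h :: "complex^2^2" where "sl2_h = mat2 (1/2) 0 0 (- (1/2))"

lemma sl2_basis_in: "sl2_e \<in> sl2" "sl2_f \<in> sl2" "sl2_h \<in> sl2"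
  by (simp_all add: sl2_def trace_def sum_2 sl2_e_def sl2_f_def sl2_h_def)

lemma sl2_relations:
  "lie_bracket sl2_h sl2_e = sl2_e"
  "lie_bracket sl2_h sl2_f = - sl2_f"
  "lie_bracket sl2_e sl2_f = map_matrix ((*) 2) sl2_h"
  by (simp_all add: lie_bracket_def sl2_e_def sl2_f_def sl2_h_def vec_eq_iff forall_2
      matrix_matrix_mult_def sum_2)

lemma sl2_expand:
  assumes "x \<in> sl2"
  shows "x = map_matrix ((*) (x $ 1 $ 2)) sl2_e + map_matrix ((*) (x $ 2 $ 1)) sl2_f
    + map_matrix ((*) (2 * x $ 1 $ 1)) sl2_h"
  using assms
  by (simp add: sl2_def trace_def sum_2 sl2_e_def sl2_f_def sl2_h_def vec_eq_iff forall_2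
      add_eq_0_iff)

(* The action map is total on matrices; only its values on sl2 are constrained. *)
locale sl2_module = vector_space scale
  for scale :: "complex \<Rightarrow> 'v::ab_group_add \<Rightarrow> 'v" +
  fixes act :: "complex^2^2 \<Rightarrow> 'v \<Rightarrow> 'v"
  assumes act_linear: "x \<in> sl2 \<Longrightarrow> Vector_Spaces.linear scale scale (act x)"
    and act_add: "x \<in> sl2 \<Longrightarrow> y \<in> sl2 \<Longrightarrow> act (x + y) v = act x v + act y v"
    and act_scale: "x \<in> sl2 \<Longrightarrow> act (map_matrix ((*) c) x) v = scale c (act x v)"
    and act_bracket: "x \<in> sl2 \<Longrightarrow> y \<in> sl2 \<Longrightarrow>
      act (lie_bracket x y) v = act x (act y v) - act y (act x v)"
begin

definition submodule :: "'v set \<Rightarrow> bool" where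
  "submodule N \<longleftrightarrow> subspace N \<and> (\<forall>x\<in>sl2. \<forall>v\<in>N. act x v \<in> N)"

end

locale simple_sl2_module = sl2_module scale act
  for scale :: "complex \<Rightarrow> 'v::ab_group_add \<Rightarrow> 'v" and act :: "complex^2^2 \<Rightarrow> 'v \<Rightarrow> 'v" +
  assumes nonzero: "\<exists>v::'v. v \<noteq> 0"
    and simple: "submodule N \<Longrightarrow> N = {0} \<or> N = UNIV"

definition sigma_poly :: "complex poly \<Rightarrow> complex poly" where
  "sigma_poly r = r \<circ>\<^sub>p [:-1, 1:]"

definition sigma_inv_poly :: "complex poly \<Rightarrow> complex poly" where
  "sigma_inv_poly r = r \<circ>\<^sub>p [:1, 1:]"

lemma sigma_sigma_inv [simp]: "sigma_poly (sigma_inv_poly r) = r" "sigma_inv_poly (sigma_poly r) = r"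
  by (simp_all add: sigma_poly_def sigma_inv_poly_def pcompose_assoc [symmetric] pcompose_pCons
      pcompose_idR)

lemma sigma_poly_simps [simp]:
  "sigma_poly (r + s) = sigma_poly r + sigma_poly s"
  "sigma_poly (r * s) = sigma_poly r * sigma_poly s"
  "sigma_poly (- r) = - sigma_poly r"
  "sigma_poly (smult c r) = smult c (sigma_poly r)"
  "sigma_poly 1 = 1" "sigma_poly 0 = 0"
  by (simp_all add: sigma_poly_def pcompose_add pcompose_mult pcompose_uminus
      pcompose_smult pcompose_1)

lemma sigma_inv_poly_simps [simp]:
  "sigma_inv_poly (r + s) = sigma_inv_poly r + sigma_inv_poly s"
  "sigma_inv_poly (r * s) = sigma_inv_poly r * sigma_inv_poly s"
  "sigma_inv_poly (- r) = - sigma_inv_poly r"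
  "sigma_inv_poly (smult c r) = smult c (sigma_inv_poly r)"
  "sigma_inv_poly 1 = 1" "sigma_inv_poly 0 = 0"
  by (simp_all add: sigma_inv_poly_def pcompose_add pcompose_mult pcompose_uminus
      pcompose_smult pcompose_1)

definition map_vec :: "('a \<Rightarrow> 'b) \<Rightarrow> 'a^'n \<Rightarrow> 'b^'n" where
  "map_vec g v = (\<chi> i. g (v $ i))"

lemma map_vec_nth [simp]: "map_vec g v $ i = g (v $ i)"
  by (simp add: map_vec_def)

definition GL2 :: "(complex poly^2^2) set" where
  "GL2 = {K. invertible K}"

(* The polynomial variable plays the role of h, so [:1 - \<alpha>, 1:] is h - \<alpha> + 1 and [:\<alpha>, 1:] is
   h + \<alpha>. Intended for a in {(2,0,0), (0,2,0), (0,0,2)}; the last branch is the case (0,0,2). *)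
definition p_poly :: "complex \<Rightarrow> nat \<times> nat \<times> nat \<Rightarrow> complex poly" where
  "p_poly \<alpha> a = (if a = (2,0,0) then 1
     else if a = (0,2,0) then [:1 - \<alpha>, 1:]
     else [:1 - \<alpha>, 1:] * [:\<alpha>, 1:])"

definition q_poly :: "complex \<Rightarrow> nat \<times> nat \<times> nat \<Rightarrow> complex poly" where
  "q_poly \<alpha> a = (THE q. p_poly \<alpha> a * q = - ([:1 - \<alpha>, 1:] * [:\<alpha>, 1:]))"

lemma p_poly_nonzero: "p_poly \<alpha> a \<noteq> 0"
  by (simp add: p_poly_def)

lemma q_poly_unique:
  assumes "p_poly \<alpha> a * q = - ([:1 - \<alpha>, 1:] * [:\<alpha>, 1:])"
  shows "q_poly \<alpha> a = q"
  unfolding q_poly_def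
proof (rule the_equality)
  fix q' assume "p_poly \<alpha> a * q' = - ([:1 - \<alpha>, 1:] * [:\<alpha>, 1:])"
  then have "p_poly \<alpha> a * q' = p_poly \<alpha> a * q" by (rule trans) (rule assms [symmetric])
  then show "q' = q" by (rule mult_left_cancel [OF p_poly_nonzero, THEN iffD1])
qed (rule assms)

lemma q_poly_eq:
  "q_poly \<alpha> (2,0,0) = - ([:1 - \<alpha>, 1:] * [:\<alpha>, 1:])"
  "q_poly \<alpha> (0,2,0) = - [:\<alpha>, 1:]"
  "q_poly \<alpha> (0,0,2) = - 1"
  by (rule q_poly_unique, simp add: p_poly_def)+

lemma p_q_poly:
  assumes "a \<in> {(2,0,0), (0,2,0), (0,0,2)}"
  shows "p_poly \<alpha> a * q_poly \<alpha> a = - ([:1 - \<alpha>, 1:] * [:\<alpha>, 1:])"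
  using assms by (auto simp: q_poly_eq p_poly_def one_pCons)

definition cscale :: "complex \<Rightarrow> complex poly^2 \<Rightarrow> complex poly^2" where
  "cscale c v = map_vec (smult c) v"

definition M_h :: "complex poly^2 \<Rightarrow> complex poly^2" where
  "M_h v = [:0, 1:] *s v"

definition M_e ::
    "complex \<Rightarrow> nat \<times> nat \<times> nat \<Rightarrow> complex poly^2^2 \<Rightarrow> complex poly^2 \<Rightarrow> complex poly^2" where
  "M_e \<alpha> a K v = map_vec sigma_poly (q_poly \<alpha> a *s (matrix_inv K *v v))"

definition M_f ::
    "complex \<Rightarrow> nat \<times> nat \<times> nat \<Rightarrow> complex poly^2^2 \<Rightarrow> complex poly^2 \<Rightarrow> complex poly^2" where
  "M_f \<alpha> a K v = p_poly \<alpha> a *s (K *v map_vec sigma_inv_poly v)"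

(* Linear extension of the actions of e, f, h, with coordinates as in sl2_expand. *)
definition M_act ::
    "complex \<Rightarrow> nat \<times> nat \<times> nat \<Rightarrow> complex poly^2^2 \<Rightarrow> complex^2^2 \<Rightarrow> complex poly^2 \<Rightarrow> complex poly^2" where
  "M_act \<alpha> a K x v = cscale (x $ 1 $ 2) (M_e \<alpha> a K v) + cscale (x $ 2 $ 1) (M_f \<alpha> a K v)
     + cscale (2 * x $ 1 $ 1) (M_h v)"

lemma M_act_basis:
  "M_act \<alpha> a K sl2_e = M_e \<alpha> a K" "M_act \<alpha> a K sl2_f = M_f \<alpha> a K" "M_act \<alpha> a K sl2_h = M_h"
  by (simp_all add: fun_eq_iff M_act_def cscale_def sl2_e_def sl2_f_def sl2_h_def vec_eq_iff)

lemma matrix_inv_GL2: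
  assumes "K \<in> GL2"
  shows "K ** matrix_inv K = mat 1" "matrix_inv K ** K = mat 1"
proof -
  have "\<exists>L. K ** L = mat 1 \<and> L ** K = mat 1"
    using assms by (simp add: GL2_def invertible_def)
  then have "K ** matrix_inv K = mat 1 \<and> matrix_inv K ** K = mat 1"
    unfolding matrix_inv_def by (rule someI_ex)
  then show "K ** matrix_inv K = mat 1" "matrix_inv K ** K = mat 1" by auto
qed

lemma vector_space_cscale: "vector_space cscale"
  by unfold_locales
    (simp_all add: cscale_def vec_eq_iff smult_add_right smult_add_left)

lemma map_vec_sigma_poly:
  "map_vec sigma_poly (u + v) = map_vec sigma_poly u + map_vec sigma_poly v"
  "map_vec sigma_poly (cscale c v) = cscale c (map_vec sigma_poly v)"
  "map_vec sigma_poly (r *s v) = sigma_poly r *s map_vec sigma_poly v"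
  "map_vec sigma_inv_poly (u + v) = map_vec sigma_inv_poly u + map_vec sigma_inv_poly v"
  "map_vec sigma_inv_poly (cscale c v) = cscale c (map_vec sigma_inv_poly v)"
  "map_vec sigma_inv_poly (r *s v) = sigma_inv_poly r *s map_vec sigma_inv_poly v"
  "map_vec sigma_poly (map_vec sigma_inv_poly v) = v"
  "map_vec sigma_inv_poly (map_vec sigma_poly v) = v"
  by (simp_all add: vec_eq_iff cscale_def)

lemma mult_cscale:
  "r *s cscale c v = cscale c (r *s v)" "A *v cscale c v = cscale c (A *v v)"
  by (simp_all add: vec_eq_iff cscale_def matrix_vector_mult_def sum_2 smult_add_right)

lemma mult_vec:
  fixes u v :: "complex poly^2"
  shows "r *s (u + v) = r *s u + r *s v" "A *v (r *s v) = r *s (A *v v)"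
    "r *s (s *s v) = (r * s) *s v"
  by (simp_all add: vec_eq_iff matrix_vector_mult_def sum_2 algebra_simps)

lemma M_linear:
  "M_h (u + v) = M_h u + M_h v" "M_h (cscale c v) = cscale c (M_h v)"
  "M_e \<alpha> a K (u + v) = M_e \<alpha> a K u + M_e \<alpha> a K v"
  "M_e \<alpha> a K (cscale c v) = cscale c (M_e \<alpha> a K v)"
  "M_f \<alpha> a K (u + v) = M_f \<alpha> a K u + M_f \<alpha> a K v"
  "M_f \<alpha> a K (cscale c v) = cscale c (M_f \<alpha> a K v)"
  by (simp_all add: M_h_def M_e_def M_f_def map_vec_sigma_poly mult_cscale mult_vec
      matrix_vector_right_distrib)

lemma sigma_poly_pCons:
  "sigma_poly [:b, c:] = [:b - c, c:]" "sigma_inv_poly [:b, c:] = [:b + c, c:]"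
  by (simp_all add: sigma_poly_def sigma_inv_poly_def pcompose_pCons)

lemma M_h_e: "M_h (M_e \<alpha> a K v) = M_e \<alpha> a K v + M_e \<alpha> a K (M_h v)"
proof -
  have *: "sigma_poly (pCons 0 r) = pCons 0 (sigma_poly r) - sigma_poly r" for r
    using sigma_poly_simps(2) [of "[:0, 1:]" r] by (simp add: sigma_poly_pCons)
  then show ?thesis
    unfolding M_h_def M_e_def mult_vec map_vec_sigma_poly
    by (simp add: vec_eq_iff sigma_poly_pCons * left_diff_distrib mult.assoc)
qed

lemma M_h_f: "M_h (M_f \<alpha> a K v) = M_f \<alpha> a K (M_h v) - M_f \<alpha> a K v"
proof -
  have "[:1, 1:] * r = [:0, 1:] * r + (r :: complex poly)" for r by simp
  then show ?thesis
    unfolding M_h_def M_f_def mult_vec map_vec_sigma_poly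
    by (simp add: vec_eq_iff sigma_poly_pCons algebra_simps)
qed

lemma M_e_f:
  assumes "a \<in> {(2,0,0), (0,2,0), (0,0,2)}" and "K \<in> GL2"
  shows "M_e \<alpha> a K (M_f \<alpha> a K v) = M_f \<alpha> a K (M_e \<alpha> a K v) + cscale 2 (M_h v)"
proof -
  have "M_e \<alpha> a K (M_f \<alpha> a K v) = sigma_poly (p_poly \<alpha> a * q_poly \<alpha> a) *s v"
    by (simp add: M_e_def M_f_def mult_vec map_vec_sigma_poly matrix_vector_mul_assoc
        matrix_inv_GL2 assms mult.commute)
  moreover have "M_f \<alpha> a K (M_e \<alpha> a K v) = (p_poly \<alpha> a * q_poly \<alpha> a) *s v"
    by (simp add: M_e_def M_f_def mult_vec map_vec_sigma_poly matrix_vector_mul_assoc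
        matrix_inv_GL2 assms)
  moreover have "sigma_poly (p_poly \<alpha> a * q_poly \<alpha> a) = p_poly \<alpha> a * q_poly \<alpha> a + [:0, 2:]"
    unfolding p_q_poly [OF assms(1)] sigma_poly_simps sigma_poly_pCons
    by (simp add: algebra_simps)
  moreover have "cscale 2 (M_h v) = [:0, 2:] *s v"
    by (simp add: cscale_def M_h_def vec_eq_iff)
  ultimately show ?thesis by (simp add: vec_eq_iff distrib_right)
qed

lemma sl2_module_M:
  assumes "a \<in> {(2,0,0), (0,2,0), (0,0,2)}" and "K \<in> GL2"
  shows "sl2_module cscale (M_act \<alpha> a K)"
proof -
  interpret vector_space cscale by (rule vector_space_cscale)
  let ?act = "M_act \<alpha> a K"
  show ?thesis
  proof (intro sl2_module.intro sl2_module_axioms.intro vector_space_cscale)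
    fix x y :: "complex^2^2" and v c
    show "Vector_Spaces.linear cscale cscale (?act x)"
      unfolding Vector_Spaces.linear_iff
      by (simp add: vector_space_cscale M_act_def M_linear scale_right_distrib mult.commute)
    show "?act (x + y) v = ?act x v + ?act y v"
      by (simp add: M_act_def scale_left_distrib algebra_simps)
    show "?act (map_matrix ((*) c) x) v = cscale c (?act x v)"
      by (simp add: M_act_def scale_right_distrib mult.left_commute)
    assume "x \<in> sl2" "y \<in> sl2"
    then have tr: "x $ 2 $ 2 = - (x $ 1 $ 1)" "y $ 2 $ 2 = - (y $ 1 $ 1)"
      by (simp_all add: sl2_def trace_def sum_2 add_eq_0_iff)
    have S: "cscale c u $ i = [:c:] * (u $ i)" for c u i
      by (simp add: cscale_def)
    have C: "[:b + c:] = [:b:] + [:c:]" "[:b - c:] = [:b:] - [:c:]"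
      "[:b * c:] = [:b:] * [:c:]" "[:- c:] = - [:c:]" "[:2:] = 2" for b c :: complex
      by (simp_all add: numeral_poly)
    show "?act (lie_bracket x y) v = ?act x (?act y v) - ?act y (?act x v)"
      unfolding M_act_def M_linear M_h_e M_h_f M_e_f [OF assms]
      by (simp add: lie_bracket_def matrix_matrix_mult_def sum_2 tr vec_eq_iff S C
          del: mult_pCons_left mult_pCons_right) (simp add: algebra_simps)
  qed
qed

definition S_set :: "(complex poly^2^2) set" where
  "S_set = {K \<in> GL2. \<not> (\<exists>a b P. a \<noteq> 0 \<and> b \<noteq> 0 \<and> P \<in> GL2 \<and>
     K = matrix_inv P ** mat2 [:a:] 0 0 [:b:] ** map_matrix sigma_inv_poly P)}"

end

theory Submission
  imports Defs "HOL-Computational_Algebra.Fundamental_Theorem_Algebra"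
begin

text \<open>
  A submodule \<open>N\<close> is in particular a \<open>\<complex>[h]\<close>-submodule of \<open>\<complex>[h]\<^sup>2\<close>, so it has rank 0, 1 or 2, and the
  two positive ranks account for the two conditions on the parameters.

  \<^item> Rank 2. The polynomials \<open>d\<close> that map the whole module into \<open>N\<close> form a nonzero ideal, with generator
    \<open>g\<close>. Because \<open>K\<close> is invertible, it drops out of the action on this ideal: \<open>g\<close> divides both
    \<open>p(h) g(h+1)\<close> and \<open>q(h-1) g(h-1)\<close>. If \<open>N\<close> is proper, then \<open>g\<close> has a root \<open>r\<close>, and by finiteness of the
    set of roots the chain \<open>r, r+1, \<dots>\<close> must run into a root of \<open>p\<close> and the chain \<open>r, r-1, \<dots>\<close> into a
    root of \<open>q(h-1)\<close> (lemma \<open>full_rank_submodule\<close>). When \<open>p\<close> or \<open>q\<close> is constant this is impossible; in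
    the remaining case the end points are \<open>\<alpha>-1\<close> and \<open>1-\<alpha>\<close>, so that \<open>2\<alpha>-2\<close> is a natural number.
    Conversely, for such \<open>\<alpha>\<close> the product of the \<open>h-r\<close> over all \<open>r\<close> in \<open>{1-\<alpha>, 2-\<alpha>, \<dots>, \<alpha>-1}\<close> generates a
    proper submodule \<open>g\<cdot>\<complex>[h]\<^sup>2\<close> (lemma \<open>finite_dimensional_quotient\<close>).

  \<^item> Rank 1. All vectors of \<open>N\<close> are multiples of one unimodular vector \<open>w\<close>, and stability under \<open>f\<close>
    forces \<open>K(h) w(h+1)\<close> to be proportional to \<open>w(h)\<close>. Completing \<open>w\<close> to a basis makes \<open>K\<close> upper
    triangular up to the twisted conjugation \<open>K \<mapsto> P(h) K P(h+1)\<^sup>-\<^sup>1\<close>, with nonzero constants \<open>a, b\<close>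
    on the diagonal because \<open>K\<close> is invertible. The upper right entry can then be removed, since
    \<open>a u(h+1) - b u(h) = c\<close> has a polynomial solution \<open>u\<close> for every \<open>c\<close>
    (lemma \<open>twisted_difference_surj\<close>); so \<open>K\<close> does not lie in \<open>\<S>\<close>. Conversely, if \<open>K\<close> is
    twisted conjugate to a constant diagonal matrix, then the first basis vector spans a submodule
    of rank 1 (lemma \<open>diagonal_invariant_line\<close>).
\<close>

section \<open>Submodules as modules over the polynomial ring\<close>

definition poly_submodule ::
    "complex \<Rightarrow> nat \<times> nat \<times> nat \<Rightarrow> complex poly^2^2 \<Rightarrow> (complex poly^2) set \<Rightarrow> bool" where
  "poly_submodule \<alpha> a K N \<longleftrightarrow> 0 \<in> N \<and> (\<forall>u\<in>N. \<forall>v\<in>N. u + v \<in> N) \<and>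
    (\<forall>r. \<forall>v\<in>N. r *s v \<in> N) \<and> (\<forall>v\<in>N. M_e \<alpha> a K v \<in> N \<and> M_f \<alpha> a K v \<in> N)"

lemma cscale_eq_vector_scalar_mult: "cscale c v = [:c:] *s v"
  by (simp add: cscale_def vec_eq_iff)

text \<open>
  Since \<open>h\<close> acts as multiplication by the variable, stability under \<open>h\<close> turns a complex subspace
  into a \<open>\<complex>[h]\<close>-submodule; the actions of \<open>e, f, h\<close> determine the whole action.
\<close>

lemma submodule_iff_poly_submodule:
  assumes "a \<in> {(2,0,0), (0,2,0), (0,0,2)}" and "K \<in> GL2"
  shows "sl2_module.submodule cscale (M_act \<alpha> a K) N \<longleftrightarrow> poly_submodule \<alpha> a K N"
proof -
  interpret sl2_module cscale "M_act \<alpha> a K"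
    by (rule sl2_module_M [OF assms])
  show ?thesis
  proof
    assume "submodule N"
    then have sub: "subspace N" and act: "\<And>x v. x \<in> sl2 \<Longrightarrow> v \<in> N \<Longrightarrow> M_act \<alpha> a K x v \<in> N"
      by (auto simp: submodule_def)
    have h: "M_h v \<in> N" and e: "M_e \<alpha> a K v \<in> N" and f: "M_f \<alpha> a K v \<in> N" if "v \<in> N" for v
      using act [OF sl2_basis_in(3) that] act [OF sl2_basis_in(1) that]
        act [OF sl2_basis_in(2) that] by (simp_all add: M_act_basis)
    have "r *s v \<in> N" if "v \<in> N" for r v
    proof (induction r)
      case 0
      then show ?case using subspace_0 [OF sub] by simp
    next
      case (pCons c r)
      have "pCons c r *s v = cscale c v + M_h (r *s v)"
        by (simp add: cscale_def M_h_def vec_eq_iff)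
      then show ?case
        using sub that pCons.IH h by (simp add: subspace_add subspace_scale)
    qed
    then show "poly_submodule \<alpha> a K N"
      using subspace_0 [OF sub] subspace_add [OF sub] e f by (simp add: poly_submodule_def)
  next
    assume N: "poly_submodule \<alpha> a K N"
    then have "subspace N"
      by (auto simp: poly_submodule_def cscale_eq_vector_scalar_mult intro!: subspaceI)
    with N show "submodule N"
      by (simp add: submodule_def poly_submodule_def M_act_def M_h_def
          cscale_eq_vector_scalar_mult)
  qed
qed

lemma simple_iff_poly_submodule:
  assumes "a \<in> {(2,0,0), (0,2,0), (0,0,2)}" and "K \<in> GL2"
  shows "simple_sl2_module cscale (M_act \<alpha> a K) \<longleftrightarrow>
    (\<forall>N. poly_submodule \<alpha> a K N \<longrightarrow> N = {0} \<or> N = UNIV)"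
proof -
  have "(1 :: complex poly^2) \<noteq> 0" by (simp add: vec_eq_iff)
  then show ?thesis
    unfolding simple_sl2_module_def simple_sl2_module_axioms_def
    using sl2_module_M [OF assms, of \<alpha>] submodule_iff_poly_submodule [OF assms, of \<alpha>] by blast
qed

section \<open>Submodules of full rank\<close>

text \<open>
  Division with remainder by a nonzero element of minimal degree.
\<close>

lemma poly_ideal_generator:
  fixes I :: "'a::field poly set"
  assumes "d \<in> I" "d \<noteq> 0"
    and diff: "\<And>x y. x \<in> I \<Longrightarrow> y \<in> I \<Longrightarrow> x - y \<in> I"
    and mult: "\<And>r x. x \<in> I \<Longrightarrow> r * x \<in> I"
  obtains g where "g \<in> I" "g \<noteq> 0" "\<And>x. x \<in> I \<Longrightarrow> g dvd x"
proof -
  obtain g where g: "g \<in> I" "g \<noteq> 0" "\<And>x. x \<in> I \<Longrightarrow> x \<noteq> 0 \<Longrightarrow> degree g \<le> degree x"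
    using arg_min_nat_lemma [of "\<lambda>x. x \<in> I \<and> x \<noteq> 0" d degree] assms(1,2) by blast
  have "g dvd x" if "x \<in> I" for x
  proof -
    have "x mod g = x - x div g * g" by (simp add: minus_div_mult_eq_mod)
    then have "x mod g \<in> I" using diff mult that g(1) by simp
    then have "x mod g = 0"
      using g(3) [of "x mod g"] degree_mod_less [OF g(2), of x] by (metis leD)
    then show ?thesis by auto
  qed
  then show ?thesis using g that by blast
qed

text \<open>
  A root \<open>r\<close> of \<open>g\<close> is a root of \<open>p\<close> or else \<open>r + c\<close> is again a root of \<open>g\<close>. As \<open>g\<close> has only
  finitely many roots, moving on by \<open>c\<close> eventually meets a root of \<open>p\<close>.
\<close>

lemma root_chain_ends:
  fixes g p :: "complex poly"
  assumes "g \<noteq> 0" and dvd: "g dvd p * (g \<circ>\<^sub>p [:c, 1:])" and "c \<noteq> 0" and "poly g r = 0"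
  shows "\<exists>k :: nat. poly p (r + of_nat k * c) = 0"
proof (rule ccontr)
  assume no: "\<nexists>k :: nat. poly p (r + of_nat k * c) = 0"
  have root: "poly g (r + of_nat k * c) = 0" for k :: nat
  proof (induction k)
    case 0
    then show ?case using assms by simp
  next
    case (Suc k)
    obtain t where "p * (g \<circ>\<^sub>p [:c, 1:]) = g * t" using dvd by (rule dvdE)
    then have "poly (p * (g \<circ>\<^sub>p [:c, 1:])) (r + of_nat k * c) = 0"
      by (simp only: poly_mult Suc.IH mult_zero_left)
    then show ?case using no by (simp add: poly_pcompose algebra_simps)
  qed
  have "inj (\<lambda>k :: nat. r + of_nat k * c)"
    using \<open>c \<noteq> 0\<close> by (auto simp: inj_def)
  then have "infinite (range (\<lambda>k :: nat. r + of_nat k * c))"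
    using finite_imageD by blast
  moreover have "range (\<lambda>k :: nat. r + of_nat k * c) \<subseteq> {x. poly g x = 0}"
    using root by auto
  ultimately show False
    using poly_roots_finite [OF \<open>g \<noteq> 0\<close>] finite_subset by blast
qed

text \<open>
  \<open>K\<close> acts bijectively on \<open>\<complex>[h]\<^sup>2\<close>, so applying \<open>f\<close> or \<open>e\<close> to all of \<open>d\<cdot>\<complex>[h]\<^sup>2\<close> gives all multiples
  of the polynomials \<open>p(h) d(h+1)\<close> and \<open>q(h-1) d(h-1)\<close>: modulo \<open>N\<close>, scalar annihilators behave as
  they do for a module of rank 1.
\<close>

lemma annihilator_shift:
  assumes K: "K \<in> GL2" and N: "poly_submodule \<alpha> a K N" and d: "\<And>v. d *s v \<in> N"
  shows "(p_poly \<alpha> a * sigma_inv_poly d) *s v \<in> N"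
    and "(sigma_poly (q_poly \<alpha> a) * sigma_poly d) *s v \<in> N"
proof -
  have "M_f \<alpha> a K (d *s map_vec sigma_poly (matrix_inv K *v v)) \<in> N"
    using N d by (simp add: poly_submodule_def)
  also have "M_f \<alpha> a K (d *s map_vec sigma_poly (matrix_inv K *v v)) =
      (p_poly \<alpha> a * sigma_inv_poly d) *s v"
    by (simp add: M_f_def map_vec_sigma_poly mult_vec matrix_vector_mul_assoc
        matrix_inv_GL2 K)
  finally show "(p_poly \<alpha> a * sigma_inv_poly d) *s v \<in> N" .
  have "M_e \<alpha> a K (d *s (K *v map_vec sigma_inv_poly v)) \<in> N"
    using N d by (simp add: poly_submodule_def)
  also have "M_e \<alpha> a K (d *s (K *v map_vec sigma_inv_poly v)) =
      (sigma_poly (q_poly \<alpha> a) * sigma_poly d) *s v"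
    by (simp add: M_e_def map_vec_sigma_poly mult_vec matrix_vector_mul_assoc
        matrix_inv_GL2 K)
  finally show "(sigma_poly (q_poly \<alpha> a) * sigma_poly d) *s v \<in> N" .
qed

text \<open>
  The generator \<open>g\<close> of the annihilator of the quotient by \<open>N\<close> is not constant when \<open>N\<close> is proper. A
  root of \<open>g\<close> then starts an ascending chain ending at a root of \<open>p\<close> and a descending chain ending at
  a root of \<open>q(h-1)\<close>.
\<close>

lemma full_rank_submodule:
  assumes K: "K \<in> GL2" and N: "poly_submodule \<alpha> a K N"
    and d: "d \<noteq> 0" "\<And>v. d *s v \<in> N" and "N \<noteq> UNIV"
  shows "\<exists>r. \<exists>k l :: nat. poly (p_poly \<alpha> a) (r + of_nat k) = 0 \<and>
    poly (sigma_poly (q_poly \<alpha> a)) (r - of_nat l) = 0"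
proof -
  define I where "I = {d. \<forall>v. d *s v \<in> N}"
  have diff: "x - y \<in> I" if "x \<in> I" "y \<in> I" for x y
  proof -
    have "x *s v + (- 1) *s (y *s v) \<in> N" for v
      using that N unfolding I_def poly_submodule_def by blast
    moreover have "x *s v + (- 1) *s (y *s v) = (x - y) *s v" for v
      by (simp add: vec_eq_iff algebra_simps)
    ultimately have "(x - y) *s v \<in> N" for v by metis
    then show ?thesis unfolding I_def by blast
  qed
  have mult: "r * x \<in> I" if "x \<in> I" for r x
  proof -
    have "(r * x) *s v = r *s (x *s v)" for v by (simp add: vec_eq_iff mult.assoc)
    moreover have "r *s (x *s v) \<in> N" for v
      using that N unfolding I_def poly_submodule_def by blast
    ultimately show ?thesis unfolding I_def by simp
  qed
  have "d \<in> I" using d by (simp add: I_def)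
  then obtain g where g: "g \<in> I" "g \<noteq> 0" "\<And>x. x \<in> I \<Longrightarrow> g dvd x"
    using poly_ideal_generator [OF _ d(1) diff mult] by blast
  have "\<not> constant (poly g)"
  proof
    assume "constant (poly g)"
    then have "g dvd 1" using g(2) by (simp add: constant_degree is_unit_iff_degree)
    then obtain u where "1 = g * u" by (rule dvdE)
    then have "1 \<in> I" using mult [OF g(1), of u] by (simp add: mult.commute)
    then show False using \<open>N \<noteq> UNIV\<close> by (auto simp: I_def)
  qed
  then obtain r where r: "poly g r = 0" using fundamental_theorem_of_algebra by blast
  have gN: "g *s v \<in> N" for v using g(1) by (simp add: I_def)
  have "g dvd p_poly \<alpha> a * (g \<circ>\<^sub>p [:1, 1:])"
    using g(3) annihilator_shift(1) [OF K N gN] by (simp add: I_def sigma_inv_poly_def)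
  then obtain k :: nat where "poly (p_poly \<alpha> a) (r + of_nat k * 1) = 0"
    using root_chain_ends [OF g(2) _ _ r, of "p_poly \<alpha> a" 1] by auto
  moreover have "g dvd sigma_poly (q_poly \<alpha> a) * (g \<circ>\<^sub>p [:-1, 1:])"
    using g(3) annihilator_shift(2) [OF K N gN] by (simp add: I_def sigma_poly_def)
  then obtain l :: nat where "poly (sigma_poly (q_poly \<alpha> a)) (r + of_nat l * (-1)) = 0"
    using root_chain_ends [OF g(2) _ _ r, of "sigma_poly (q_poly \<alpha> a)" "-1"] by auto
  ultimately show ?thesis by auto
qed

text \<open>
  For \<open>(2,0,0)\<close> and \<open>(0,0,2)\<close> one of \<open>p\<close>, \<open>q\<close> is a nonzero constant and has no root. For \<open>(0,2,0)\<close>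
  the roots in question are \<open>\<alpha>-1\<close> and \<open>1-\<alpha>\<close>, whose difference is \<open>k+l\<close>.
\<close>

lemma full_rank_submodule_parameters:
  assumes a: "a \<in> {(2,0,0), (0,2,0), (0,0,2)}"
    and roots: "poly (p_poly \<alpha> a) (r + of_nat k) = 0"
      "poly (sigma_poly (q_poly \<alpha> a)) (r - of_nat l) = 0"
  shows "a = (0,2,0) \<and> \<alpha> \<in> {of_nat n / 2 + 1 | n :: nat. True}"
proof -
  have "a = (0,2,0)"
    using assms by (auto simp: p_poly_def q_poly_eq)
  moreover from this have "r = \<alpha> - 1 - of_nat k" "r - of_nat l = 1 - \<alpha>"
    using roots by (auto simp: p_poly_def q_poly_eq sigma_poly_pCons algebra_simps add_eq_0_iff)
  then have "2 * \<alpha> = of_nat k + of_nat l + 2" by algebra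
  then have "\<alpha> = of_nat (k + l) / 2 + 1" by (simp add: field_simps)
  ultimately show ?thesis by blast
qed

section \<open>Twisted conjugacy and triangular matrices\<close>

text \<open>
  Change of basis for the semilinear map \<open>v \<mapsto> K(h) v(h+1)\<close>. The condition \<open>L = P(h) K P(h+1)\<^sup>-\<^sup>1\<close> is
  written without inverses, so that it composes and can be checked entrywise.
\<close>

definition twisted_conj :: "complex poly^2^2 \<Rightarrow> complex poly^2^2 \<Rightarrow> bool" where
  "twisted_conj K L \<longleftrightarrow> (\<exists>P\<in>GL2. P ** K = L ** map_matrix sigma_inv_poly P)"

lemma map_matrix_sigma_inv_mult:
  "map_matrix sigma_inv_poly (A ** B) =
    map_matrix sigma_inv_poly A ** map_matrix sigma_inv_poly (B :: complex poly^2^2)"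
  by (simp add: vec_eq_iff matrix_matrix_mult_def sum_2)

lemma map_vec_sigma_inv_mult:
  "map_vec sigma_inv_poly (A *v v) =
    map_matrix sigma_inv_poly A *v map_vec sigma_inv_poly (v :: complex poly^2)"
  by (simp add: vec_eq_iff matrix_vector_mult_def sum_2)

lemma map_matrix_sigma_inv_one: "map_matrix sigma_inv_poly (mat 1) = (mat 1 :: complex poly^2^2)"
  by (simp add: vec_eq_iff mat_def)

lemma GL2I: "A ** B = mat 1 \<Longrightarrow> B ** A = mat 1 \<Longrightarrow> A \<in> GL2"
  by (auto simp: GL2_def invertible_def)

lemma GL2_mult:
  assumes "A \<in> GL2" "B \<in> GL2"
  shows "A ** B \<in> GL2"
  using assms by (simp add: GL2_def invertible_mult)

lemma twisted_conj_trans: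
  assumes "twisted_conj K L" "twisted_conj L M"
  shows "twisted_conj K M"
proof -
  obtain P Q where P: "P \<in> GL2" "P ** K = L ** map_matrix sigma_inv_poly P"
    and Q: "Q \<in> GL2" "Q ** L = M ** map_matrix sigma_inv_poly Q"
    using assms by (auto simp: twisted_conj_def)
  have "(Q ** P) ** K = Q ** L ** map_matrix sigma_inv_poly P"
    by (simp flip: matrix_mul_assoc add: P)
  also have "\<dots> = M ** map_matrix sigma_inv_poly (Q ** P)"
    by (simp add: Q matrix_mul_assoc map_matrix_sigma_inv_mult)
  finally show ?thesis using GL2_mult [OF Q(1) P(1)] by (auto simp: twisted_conj_def)
qed

lemma twisted_conj_iff:
  "twisted_conj K L \<longleftrightarrow> (\<exists>P\<in>GL2. K = matrix_inv P ** L ** map_matrix sigma_inv_poly P)"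
proof -
  have "P ** K = L ** B \<longleftrightarrow> K = matrix_inv P ** L ** B" if "P \<in> GL2" for P B
  proof
    assume "P ** K = L ** B"
    then have "matrix_inv P ** (P ** K) = matrix_inv P ** (L ** B)" by simp
    then show "K = matrix_inv P ** L ** B"
      by (simp add: matrix_mul_assoc matrix_inv_GL2 that)
  next
    assume "K = matrix_inv P ** L ** B"
    then have "P ** K = P ** matrix_inv P ** L ** B" by (simp add: matrix_mul_assoc)
    then show "P ** K = L ** B" by (simp add: matrix_inv_GL2 that)
  qed
  then show ?thesis by (auto simp: twisted_conj_def)
qed

lemma not_in_S_set_iff:
  assumes "K \<in> GL2"
  shows "K \<notin> S_set \<longleftrightarrow> (\<exists>a b. a \<noteq> 0 \<and> b \<noteq> 0 \<and> twisted_conj K (mat2 [:a:] 0 0 [:b:]))"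
  using assms unfolding S_set_def twisted_conj_iff by blast

text \<open>
  For \<open>a \<noteq> b\<close> the operator \<open>u \<mapsto> a u(h+1) - b u(h)\<close> preserves degrees, with \<open>h\<^sup>n\<close> going to leading
  coefficient \<open>a - b\<close>. For \<open>a = b\<close> it is a multiple of the difference operator and lowers degrees by
  one, so that \<open>h\<^bsup>n+1\<^esup>\<close> goes to leading coefficient \<open>a (n+1)\<close>. In both cases the image contains
  polynomials of every degree.
\<close>

lemma twisted_difference_leading_term:
  fixes a b :: complex
  assumes "a \<noteq> 0"
  shows "\<exists>m. coeff (smult a (sigma_inv_poly m) - smult b m) n \<noteq> 0 \<and>
    (\<forall>i>n. coeff (smult a (sigma_inv_poly m) - smult b m) i = 0)"
proof -
  have power: "sigma_inv_poly (monom 1 k) = [:1, 1:] ^ k" for k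
    by (induction k) (simp_all add: sigma_inv_poly_def monom_Suc pcompose_pCons pcompose_1)
  have coeff_power: "coeff ([:1, 1 :: complex:] ^ k) i = of_nat (k choose i)" for k i
  proof (cases "i \<le> k")
    case True
    then show ?thesis by (simp add: coeff_linear_poly_power)
  next
    case False
    moreover have "degree ([:1, 1 :: complex:] ^ k) = k" by (simp add: degree_power_eq)
    ultimately show ?thesis by (simp add: coeff_eq_0 binomial_eq_0)
  qed
  have *: "coeff (smult a (sigma_inv_poly (monom 1 k)) - smult b (monom 1 k)) i =
      a * of_nat (k choose i) - (if i = k then b else 0)" for k i
    by (simp add: power coeff_power)
  show ?thesis
  proof (cases "a = b")
    case True
    with assms show ?thesis
      by (intro exI [of _ "monom 1 (Suc n)"], unfold *)
        (auto simp: binomial_eq_0 simp del: of_nat_Suc)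
  next
    case False
    then show ?thesis
      by (intro exI [of _ "monom 1 n"], unfold *) (auto simp: binomial_eq_0)
  qed
qed

text \<open>
  Cancelling leading terms with images of each degree reduces any right-hand side to zero.
\<close>

lemma twisted_difference_surj:
  fixes a b :: complex
  assumes "a \<noteq> 0"
  obtains u where "smult a (sigma_inv_poly u) - smult b u = c"
proof -
  define L where "L u = smult a (sigma_inv_poly u) - smult b u" for u
  have "\<exists>u. L u = c" if "\<forall>i\<ge>n. coeff c i = 0" for n c
    using that
  proof (induction n arbitrary: c)
    case 0
    then have "L 0 = c" by (simp add: L_def poly_eq_iff)
    then show ?case ..
  next
    case (Suc n)
    obtain m where m: "coeff (L m) n \<noteq> 0" "\<And>i. i > n \<Longrightarrow> coeff (L m) i = 0"
      using twisted_difference_leading_term [OF assms] unfolding L_def by blast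
    define t where "t = coeff c n / coeff (L m) n"
    have "\<forall>i\<ge>n. coeff (c - smult t (L m)) i = 0"
    proof (intro allI impI)
      fix i assume "i \<ge> n"
      then show "coeff (c - smult t (L m)) i = 0"
        using m Suc.prems by (cases "i = n") (auto simp: t_def)
    qed
    then obtain u where "L u = c - smult t (L m)" using Suc.IH by blast
    then have "L (u + smult t m) = c"
      by (simp add: L_def smult_add_right smult_diff_right algebra_simps)
    then show ?case ..
  qed
  from this [of "Suc (degree c)" c] obtain u where "L u = c"
    by (auto simp: coeff_eq_0)
  then show ?thesis using that by (simp add: L_def)
qed

text \<open>
  Conjugating by the unipotent matrix with entry \<open>u\<close> changes the upper right entry \<open>c\<close> into
  \<open>c + b u(h) - a u(h+1)\<close>. This also covers \<open>a = b\<close>: there are no nontrivial Jordan blocks.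
\<close>

lemma upper_triangular_twisted_conj_diag:
  assumes "a \<noteq> 0"
  shows "twisted_conj (mat2 [:a:] c 0 [:b:]) (mat2 [:a:] 0 0 [:b:])"
proof -
  obtain u where u: "smult a (sigma_inv_poly u) - smult b u = c"
    using twisted_difference_surj [OF assms] .
  have "mat2 1 u 0 1 \<in> GL2"
    by (rule GL2I [of _ "mat2 1 (-u) 0 1"])
      (simp_all add: vec_eq_iff forall_2 matrix_matrix_mult_def sum_2 mat_def)
  moreover have "mat2 1 u 0 1 ** mat2 [:a:] c 0 [:b:] =
      mat2 [:a:] 0 0 [:b:] ** map_matrix sigma_inv_poly (mat2 1 u 0 1)"
    using u by (simp add: vec_eq_iff forall_2 matrix_matrix_mult_def sum_2 algebra_simps)
  ultimately show ?thesis unfolding twisted_conj_def by blast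
qed

section \<open>Submodules of rank one\<close>

definition wedge :: "'a::comm_ring_1^2 \<Rightarrow> 'a^2 \<Rightarrow> 'a" where
  "wedge u v = u $ 1 * v $ 2 - u $ 2 * v $ 1"

lemma cramer_wedge: "wedge u v *s x = wedge x v *s u + wedge u x *s v"
  by (simp add: wedge_def vec_eq_iff forall_2 algebra_simps)

lemma wedge_scale: "wedge (r *s u) (s *s v) = r * s * wedge u v"
  by (simp add: wedge_def algebra_simps)

text \<open>
  Dividing a vector by the greatest common divisor of its entries makes the entries generate the
  unit ideal; this is what allows the vector to be completed to a basis.
\<close>

lemma unimodular_direction:
  fixes v :: "'a::field poly^2"
  assumes "v \<noteq> 0"
  obtains g w s t where "v = g *s w" "g \<noteq> 0" "s * w $ 1 + t * w $ 2 = 1"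
proof -
  define I where "I = {s * v $ 1 + t * v $ 2 | s t. True}"
  have I: "s * v $ 1 + t * v $ 2 \<in> I" for s t by (auto simp: I_def)
  have v12: "v $ 1 \<in> I" "v $ 2 \<in> I" using I [of 1 0] I [of 0 1] by simp_all
  have "\<exists>d\<in>I. d \<noteq> 0" using assms v12 by (auto simp: vec_eq_iff forall_2)
  then obtain d where d: "d \<in> I" "d \<noteq> 0" by blast
  have diff: "x - y \<in> I" if x: "x \<in> I" and y: "y \<in> I" for x y
  proof -
    obtain s t s' t' where "x = s * v $ 1 + t * v $ 2" "y = s' * v $ 1 + t' * v $ 2"
      using x y unfolding I_def by blast
    then have "x - y = (s - s') * v $ 1 + (t - t') * v $ 2" by (simp add: algebra_simps)
    then show ?thesis using I by simp
  qed
  have mult: "r * x \<in> I" if x: "x \<in> I" for r x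
  proof -
    obtain s t where "x = s * v $ 1 + t * v $ 2" using x unfolding I_def by blast
    then have "r * x = (r * s) * v $ 1 + (r * t) * v $ 2" by (simp add: algebra_simps)
    then show ?thesis using I by simp
  qed
  obtain g where g: "g \<in> I" "g \<noteq> 0" "\<And>x. x \<in> I \<Longrightarrow> g dvd x"
    using poly_ideal_generator [OF d diff mult] by blast
  obtain x y where xy: "v $ 1 = g * x" "v $ 2 = g * y" using g(3) v12 by (metis dvdE)
  obtain s t where "g = s * v $ 1 + t * v $ 2" using g(1) unfolding I_def by blast
  then have "g * (s * x + t * y) = g * 1" by (simp add: xy algebra_simps)
  then have "s * x + t * y = 1" using g(2) mult_left_cancel by blast
  moreover have "v = g *s vector [x, y]" by (simp add: vec_eq_iff forall_2 xy)
  ultimately show ?thesis using that [of g "vector [x, y]" s t] g(2) by simp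
qed

text \<open>
  The vector \<open>w\<close> is completed to the basis \<open>(w, (-t, s))\<close>, whose determinant is the given
  combination \<open>1\<close>. In this basis \<open>K\<close> has lower left entry \<open>w \<wedge> K(h) w(h+1) = 0\<close>; its diagonal entries
  are then units of \<open>\<complex>[h]\<close>, that is, nonzero constants.
\<close>

lemma invariant_direction_not_in_S_set:
  assumes K: "K \<in> GL2" and st: "s * w $ 1 + t * w $ 2 = 1"
    and inv: "wedge w (K *v map_vec sigma_inv_poly w) = 0"
  shows "K \<notin> S_set"
proof -
  define P where "P = mat2 s t (- w $ 2) (w $ 1)"
  define R where "R = mat2 (w $ 1) (- t) (w $ 2) s"
  have PR: "P ** R = mat 1" and RP: "R ** P = mat 1"
    using st by (simp_all add: P_def R_def vec_eq_iff forall_2 matrix_matrix_mult_def sum_2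
        mat_def algebra_simps)
  define T where "T = P ** K ** map_matrix sigma_inv_poly R"
  define T' where "T' = map_matrix sigma_inv_poly P ** matrix_inv K ** R"
  have shift: "map_matrix sigma_inv_poly R ** map_matrix sigma_inv_poly P = mat 1"
      "map_matrix sigma_inv_poly P ** map_matrix sigma_inv_poly R = mat 1"
    by (simp_all add: PR RP map_matrix_sigma_inv_one flip: map_matrix_sigma_inv_mult)
  have "T ** map_matrix sigma_inv_poly P = P ** K"
    unfolding T_def by (simp flip: matrix_mul_assoc add: shift)
  then have KT: "twisted_conj K T"
    unfolding twisted_conj_def using GL2I [OF PR RP] by metis
  have "T ** T' = P ** K ** (map_matrix sigma_inv_poly R ** map_matrix sigma_inv_poly P)
      ** matrix_inv K ** R"
    unfolding T_def T'_def by (simp only: matrix_mul_assoc)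
  also have "\<dots> = P ** (K ** matrix_inv K) ** R"
    unfolding shift by (simp add: matrix_mul_assoc)
  finally have TT': "T ** T' = mat 1" by (simp add: matrix_inv_GL2 K PR)
  have "T' ** T = map_matrix sigma_inv_poly P ** matrix_inv K ** (R ** P) ** K
      ** map_matrix sigma_inv_poly R"
    unfolding T_def T'_def by (simp only: matrix_mul_assoc)
  also have "\<dots> = map_matrix sigma_inv_poly P ** (matrix_inv K ** K) ** map_matrix sigma_inv_poly R"
    unfolding RP by (simp add: matrix_mul_assoc)
  finally have T'T: "T' ** T = mat 1" by (simp add: matrix_inv_GL2 K shift)
  have T21: "T $ 2 $ 1 = 0"
    using inv by (simp add: T_def P_def R_def wedge_def matrix_matrix_mult_def
        matrix_vector_mult_def sum_2 algebra_simps)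
  have "(T' ** T) $ 1 $ 1 = 1" "(T ** T') $ 2 $ 2 = 1"
    unfolding TT' T'T by (simp_all add: mat_def)
  then have "T' $ 1 $ 1 * T $ 1 $ 1 = 1" "T $ 2 $ 2 * T' $ 2 $ 2 = 1"
    by (simp_all add: matrix_matrix_mult_def sum_2 T21)
  then have "T $ 1 $ 1 dvd 1" "T $ 2 $ 2 dvd 1"
    by (metis dvd_triv_right, metis dvd_triv_left)
  then obtain a b where "T $ 1 $ 1 = [:a:]" "a dvd 1" "T $ 2 $ 2 = [:b:]" "b dvd 1"
    using is_unit_polyE by metis
  then have ab: "T $ 1 $ 1 = [:a:]" "a \<noteq> 0" "T $ 2 $ 2 = [:b:]" "b \<noteq> 0" by auto
  then have "T = mat2 [:a:] (T $ 1 $ 2) 0 [:b:]"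
    by (simp add: vec_eq_iff forall_2 T21)
  then have "twisted_conj T (mat2 [:a:] 0 0 [:b:])"
    using upper_triangular_twisted_conj_diag [OF ab(2)] by metis
  then show ?thesis
    using twisted_conj_trans [OF KT] ab not_in_S_set_iff [OF K] by blast
qed

text \<open>
  If \<open>v = g w\<close> lies in \<open>N\<close>, then \<open>f v\<close> is a nonzero multiple of \<open>K(h) w(h+1)\<close>. Both \<open>v\<close> and \<open>f v\<close> lie
  in \<open>N\<close>, so \<open>K(h) w(h+1)\<close> is parallel to \<open>w\<close>.
\<close>

lemma rank_one_submodule:
  assumes K: "K \<in> GL2" and N: "poly_submodule \<alpha> a K N" and "N \<noteq> {0}"
    and wedge0: "\<And>u v. u \<in> N \<Longrightarrow> v \<in> N \<Longrightarrow> wedge u v = 0"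
  shows "K \<notin> S_set"
proof -
  obtain v where v: "v \<in> N" "v \<noteq> 0"
    using N \<open>N \<noteq> {0}\<close> by (auto simp: poly_submodule_def)
  obtain g w s t where w: "v = g *s w" "g \<noteq> 0" "s * w $ 1 + t * w $ 2 = 1"
    using unimodular_direction [OF v(2)] .
  have "sigma_inv_poly g \<noteq> 0"
    using w(2) by (metis sigma_sigma_inv(1) sigma_poly_simps(6))
  have "M_f \<alpha> a K v = (p_poly \<alpha> a * sigma_inv_poly g) *s (K *v map_vec sigma_inv_poly w)"
    by (simp add: M_f_def w(1) map_vec_sigma_poly mult_vec)
  moreover have "wedge v (M_f \<alpha> a K v) = 0"
    using wedge0 v(1) N by (simp add: poly_submodule_def)
  ultimately have "wedge w (K *v map_vec sigma_inv_poly w) = 0"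
    using w(2) \<open>sigma_inv_poly g \<noteq> 0\<close> by (simp add: w(1) wedge_scale p_poly_nonzero)
  then show ?thesis using invariant_direction_not_in_S_set [OF K w(3)] by blast
qed

section \<open>Construction of proper submodules\<close>

text \<open>
  If \<open>K = P(h)\<^sup>-\<^sup>1 diag(c,b) P(h+1)\<close>, then the first column \<open>w\<close> of \<open>P\<^sup>-\<^sup>1\<close> satisfies
  \<open>K(h) w(h+1) = c w(h)\<close>, so its multiples are stable under \<open>e\<close> and \<open>f\<close>.
\<close>

lemma diagonal_invariant_line:
  assumes K: "K \<in> GL2" and "K \<notin> S_set"
  obtains N where "poly_submodule \<alpha> a K N" "N \<noteq> {0}" "N \<noteq> UNIV"
proof -
  obtain c b P where c: "c \<noteq> 0" and P: "P \<in> GL2"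
    and PK: "P ** K = mat2 [:c:] 0 0 [:b:] ** map_matrix sigma_inv_poly P"
    using assms by (auto simp: not_in_S_set_iff twisted_conj_def)
  define w where "w = matrix_inv P *v axis 1 1"
  have Pw: "P *v w = axis 1 1"
    by (simp add: w_def matrix_vector_mul_assoc matrix_inv_GL2 P)
  have P_inj: "u = v" if "P *v u = P *v v" for u v
  proof -
    have "matrix_inv P *v (P *v u) = matrix_inv P *v (P *v v)" using that by simp
    then show ?thesis by (simp add: matrix_vector_mul_assoc matrix_inv_GL2 P)
  qed
  have "P *v (K *v map_vec sigma_inv_poly w) =
      mat2 [:c:] 0 0 [:b:] *v map_vec sigma_inv_poly (P *v w)"
    by (simp add: matrix_vector_mul_assoc PK map_vec_sigma_inv_mult)
  also have "\<dots> = P *v ([:c:] *s w)"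
    by (simp add: Pw mult_vec) (simp add: vec_eq_iff forall_2 matrix_vector_mult_def sum_2 axis_def)
  finally have Kw: "K *v map_vec sigma_inv_poly w = [:c:] *s w"
    by (rule P_inj)
  have "matrix_inv K *v (K *v map_vec sigma_inv_poly w) = map_vec sigma_inv_poly w"
    by (simp add: matrix_vector_mul_assoc matrix_inv_GL2 K)
  then have "[:1/c:] *s ([:c:] *s (matrix_inv K *v w)) = [:1/c:] *s map_vec sigma_inv_poly w"
    by (simp add: Kw mult_vec)
  then have Kinv: "matrix_inv K *v w = [:1/c:] *s map_vec sigma_inv_poly w"
    using c by (simp add: mult_vec flip: one_pCons)
  define N where "N = range (\<lambda>r. r *s w)"
  have N: "r *s w \<in> N" for r by (simp add: N_def)
  have "poly_submodule \<alpha> a K N"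
    unfolding poly_submodule_def
  proof (intro conjI ballI allI)
    show "0 \<in> N" using N [of 0] by simp
    show "u + v \<in> N" if u: "u \<in> N" and v: "v \<in> N" for u v
    proof -
      obtain r s where "u = r *s w" "v = s *s w" using u v unfolding N_def by blast
      then have "u + v = (r + s) *s w" by (simp add: vec_eq_iff algebra_simps)
      then show ?thesis using N by metis
    qed
    fix v assume "v \<in> N"
    then obtain r where v: "v = r *s w" by (auto simp: N_def)
    show "s *s v \<in> N" for s using N by (simp add: v mult_vec)
    show "M_f \<alpha> a K v \<in> N"
      using N by (simp only: v M_f_def map_vec_sigma_poly mult_vec Kw)
    show "M_e \<alpha> a K v \<in> N"
      using N by (simp only: v M_e_def map_vec_sigma_poly mult_vec Kinv)
  qed
  moreover have "N \<noteq> {0}"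
  proof
    assume "N = {0}"
    then have "w = 0" using N [of 1] by simp
    then have "(axis 1 1 :: complex poly^2) $ 1 = 0" using Pw by simp
    then show False by (simp add: axis_def)
  qed
  moreover have "N \<noteq> UNIV"
  proof
    assume "N = UNIV"
    then have "matrix_inv P *v axis 2 1 \<in> N" by simp
    then obtain r where "matrix_inv P *v axis 2 1 = r *s w" by (auto simp: N_def)
    then have "P *v (matrix_inv P *v axis 2 1) = r *s axis 1 1" by (simp add: mult_vec Pw)
    then have "axis 2 1 = r *s (axis 1 1 :: complex poly^2)"
      by (simp add: matrix_vector_mul_assoc matrix_inv_GL2 P)
    then have "(axis 2 1 :: complex poly^2) $ 2 = (r *s (axis 1 1 :: complex poly^2)) $ 2" by simp
    then show False by (simp add: axis_def)
  qed
  ultimately show ?thesis using that by blast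
qed

text \<open>
  Here \<open>g\<close> has the \<open>n+1\<close> roots \<open>1-\<alpha>, 2-\<alpha>, \<dots>, \<alpha>-1\<close>. Shifting them by \<open>-1\<close> loses only the root \<open>\<alpha>-1\<close>, which
  is supplied by \<open>p\<close>, and shifting them by \<open>+1\<close> loses only \<open>1-\<alpha>\<close>, which is supplied by \<open>q(h-1)\<close>. Hence
  \<open>g\<cdot>\<complex>[h]\<^sup>2\<close> is a submodule, of codimension \<open>2(n+1)\<close>.
\<close>

lemma finite_dimensional_quotient:
  fixes \<alpha> :: complex
  assumes \<alpha>: "\<alpha> = of_nat n / 2 + 1"
  obtains N where "poly_submodule \<alpha> (0,2,0) K N" "N \<noteq> {0}" "N \<noteq> UNIV"
proof -
  \<comment> \<open>\<open>F j\<close> vanishes at \<open>j - \<alpha>\<close>, so the factors \<open>F 1, \<dots>, F (n+1)\<close> of \<open>g\<close> give the roots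
    \<open>1-\<alpha>, \<dots>, n+1-\<alpha> = \<alpha>-1\<close>; \<open>F 0\<close> and \<open>F (n+2)\<close> are the factors gained by shifting.\<close>
  define F where "F j = [:\<alpha> - of_nat j, 1:]" for j
  define g where "g = (\<Prod>j\<le>n. F (Suc j))"
  have "sigma_inv_poly (F (Suc j)) = F j" "sigma_poly (F j) = F (Suc j)" for j
    by (simp_all add: F_def sigma_poly_pCons)
  then have shift: "sigma_inv_poly g = (\<Prod>j\<le>n. F j)" "sigma_poly g = (\<Prod>j\<le>n. F (Suc (Suc j)))"
    by (simp_all add: g_def sigma_inv_poly_def sigma_poly_def pcompose_prod)
  have "p_poly \<alpha> (0,2,0) = F (Suc n)"
    using \<alpha> by (simp add: p_poly_def F_def field_simps)
  then have "p_poly \<alpha> (0,2,0) * sigma_inv_poly g = (\<Prod>j\<le>Suc n. F j)"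
    by (simp add: shift)
  also have "\<dots> = F 0 * g"
    unfolding g_def by (rule prod.atMost_Suc_shift)
  finally have p: "p_poly \<alpha> (0,2,0) * sigma_inv_poly g = g * F 0" by simp
  have "sigma_poly (q_poly \<alpha> (0,2,0)) = - F 1"
    by (simp add: q_poly_eq F_def sigma_poly_pCons)
  then have "sigma_poly (q_poly \<alpha> (0,2,0)) * sigma_poly g =
      - (F (Suc 0) * (\<Prod>j\<le>n. F (Suc (Suc j))))"
    by (simp add: shift)
  also have "\<dots> = - (\<Prod>j\<le>Suc n. F (Suc j))"
    by (simp only: prod.atMost_Suc_shift)
  finally have q: "sigma_poly (q_poly \<alpha> (0,2,0)) * sigma_poly g = g * - F (Suc (Suc n))"
    by (simp add: g_def)
  define N where "N = range (\<lambda>u. g *s (u :: complex poly^2))"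
  have N: "g *s u \<in> N" for u by (simp add: N_def)
  have N': "(g * r) *s u \<in> N" for r u using N [of "r *s u"] by (simp add: mult_vec)
  have "poly_submodule \<alpha> (0,2,0) K N"
    unfolding poly_submodule_def
  proof (intro conjI ballI allI)
    show "0 \<in> N" using N [of 0] by simp
    show "u + v \<in> N" if u: "u \<in> N" and v: "v \<in> N" for u v
    proof -
      obtain u' v' where "u = g *s u'" "v = g *s v'" using u v unfolding N_def by blast
      then have "u + v = g *s (u' + v')" by (simp add: mult_vec)
      then show ?thesis using N by metis
    qed
    fix v assume "v \<in> N"
    then obtain u where v: "v = g *s u" by (auto simp: N_def)
    show "s *s v \<in> N" for s using N' [of s u] by (simp add: v mult_vec mult.commute)
    have "M_f \<alpha> (0,2,0) K v =
        (p_poly \<alpha> (0,2,0) * sigma_inv_poly g) *s (K *v map_vec sigma_inv_poly u)"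
      by (simp add: v M_f_def map_vec_sigma_poly mult_vec)
    then show "M_f \<alpha> (0,2,0) K v \<in> N" using N' unfolding p by simp
    have "M_e \<alpha> (0,2,0) K v =
        (sigma_poly (q_poly \<alpha> (0,2,0)) * sigma_poly g) *s map_vec sigma_poly (matrix_inv K *v u)"
      by (simp add: v M_e_def map_vec_sigma_poly mult_vec)
    then show "M_e \<alpha> (0,2,0) K v \<in> N" using N' unfolding q by metis
  qed
  moreover have "N \<noteq> {0}"
  proof
    assume "N = {0}"
    then have "(g *s 1) $ (1 :: 2) = (0 :: complex poly^2) $ 1" using N [of 1] by simp
    then have "g = 0" by (simp del: zero_index) simp
    then show False by (simp add: g_def F_def)
  qed
  moreover have "N \<noteq> UNIV"
  proof
    assume "N = UNIV"
    then have "1 \<in> N" by simp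
    then obtain u :: "complex poly^2" where "1 = g *s u" unfolding N_def by blast
    then have "1 = (g *s u) $ 1" by (metis one_index)
    then have "poly 1 (1 - \<alpha>) = poly (g * u $ 1) (1 - \<alpha>)" by simp
    moreover have "poly g (1 - \<alpha>) = 0"
      by (auto simp: g_def F_def poly_prod intro!: bexI [of _ 0])
    ultimately show False by simp
  qed
  ultimately show ?thesis using that by blast
qed

theorem theorem4p3:
  fixes \<alpha> :: complex and a :: "nat \<times> nat \<times> nat" and K :: "complex poly^2^2"
  assumes "a \<in> {(2,0,0), (0,2,0), (0,0,2)}" and "K \<in> GL2"
  shows "simple_sl2_module cscale (M_act \<alpha> a K) \<longleftrightarrow>
    ((a = (2,0,0) \<or> a = (0,0,2)) \<and> K \<in> S_set) \<or>
    (a = (0,2,0) \<and> K \<in> S_set \<and> \<alpha> \<notin> {of_nat n / 2 + 1 | n :: nat. True})"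
proof -
  let ?special = "a = (0,2,0) \<and> \<alpha> \<in> {of_nat n / 2 + 1 | n :: nat. True}"
  have "simple_sl2_module cscale (M_act \<alpha> a K) \<longleftrightarrow> K \<in> S_set \<and> \<not> ?special"
    unfolding simple_iff_poly_submodule [OF assms]
  proof (intro iffI conjI allI impI notI)
    assume simple: "\<forall>N. poly_submodule \<alpha> a K N \<longrightarrow> N = {0} \<or> N = UNIV"
    show "K \<in> S_set"
      using diagonal_invariant_line [OF assms(2)] simple by metis
    assume ?special
    then obtain n where "a = (0,2,0)" "\<alpha> = of_nat n / 2 + 1" by blast
    then show False using finite_dimensional_quotient [of \<alpha> n K] simple by metis
  next
    fix N assume S: "K \<in> S_set \<and> \<not> ?special" and N: "poly_submodule \<alpha> a K N"
    show "N = {0} \<or> N = UNIV"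
    proof (rule ccontr)
      assume proper: "\<not> (N = {0} \<or> N = UNIV)"
      then obtain u v where uv: "u \<in> N" "v \<in> N" "wedge u v \<noteq> 0"
        using rank_one_submodule [OF assms(2) N] S by blast
      \<comment> \<open>By Cramer's rule the determinant of two independent vectors of \<open>N\<close> multiplies the whole
        module into \<open>N\<close>, so \<open>N\<close> has full rank.\<close>
      have "wedge u v *s x \<in> N" for x
        using uv N unfolding cramer_wedge [of u v x] by (simp add: poly_submodule_def)
      then have ?special
        using full_rank_submodule [OF assms(2) N uv(3)] proper
          full_rank_submodule_parameters [OF assms(1)] by blast
      then show False using S by blast
    qed
  qed
  then show ?thesis using assms(1) by auto
qed

end
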